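(* For $n \ge 1$ and complex numbers $b\neq 0$, $c \neq 0$, we have \[ A_n(x;b)=x\sum_{m=0}^{n-1}\sum_{l_1+\cdots+l_n=m}\sum_{k=0}^{n-1}\sum_{j=0}^{k}\binom{n-1}{m}\binom{m}{l_1,\ldots,l_n}\binom{k}{j}\left(\prod_{i=1}^{n}a_{l_i}^{(-b)}(-c)\right)\frac{(-1)^j(nc)^k}{k!}(x+j)^{n-1-m}, \] where the sum over $l_1+\cdots+l_n=m$ runs over $n$-tuples of nonnegative integers.
   Context: The Abel polynomials are $A_n(x;b)=x(x-bn)^{n-1}$. The actuarial polynomials $a_l^{(\beta)}(x)$ are defined by the generating function $\sum_{l\ge0}a_l^{(\beta)}(x)\frac{t^l}{l!}=e^{\beta t+x(1-e^t)}$. $\binom{m}{l_1,\ldots,l_n}$ denotes the multinomial coefficient. *)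

theory Defs
  imports Complex_Main "HOL-Computational_Algebra.Formal_Power_Series"
begin

(* The case n = 0 is the usual convention A_0 = 1, which the formula would also give
   with the exponent -1; truncated subtraction on nat would turn it into x. *)
definition abel_poly :: "nat \<Rightarrow> complex \<Rightarrow> complex \<Rightarrow> complex" where
  "abel_poly n b x = (if n = 0 then 1 else x * (x - b * of_nat n) ^ (n - 1))"

(* exp (beta t + x (1 - exp t)) as a formal power series in t; the exponent has zero
   constant term, so the composition is the substitution into the exponential series. *)
definition actuarial_gf :: "complex \<Rightarrow> complex \<Rightarrow> complex fps" where
  "actuarial_gf \<beta> x =
     fps_exp 1 oo (fps_const \<beta> * fps_X + fps_const x * (1 - fps_exp 1))"

definition actuarial_poly :: "nat \<Rightarrow> complex \<Rightarrow> complex \<Rightarrow> complex" where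
  "actuarial_poly l \<beta> x = fact l * fps_nth (actuarial_gf \<beta> x) l"

lemma actuarial_poly_generating_function:
  "Abs_fps (\<lambda>l. actuarial_poly l \<beta> x / fact l) =
     fps_exp 1 oo (fps_const \<beta> * fps_X + fps_const x * (1 - fps_exp 1))"
  by (simp add: fps_eq_iff actuarial_poly_def actuarial_gf_def)

(* Meant for lists with sum_list ls = m. *)
definition multinomial_coeff :: "nat \<Rightarrow> nat list \<Rightarrow> complex" where
  "multinomial_coeff m ls = fact m / (\<Prod>l\<leftarrow>ls. fact l)"

end

theory Submission
  imports Defs
begin

text \<open>
  Put \<open>G = exp (- b t - c (1 - e\<^sup>t))\<close> and \<open>N = n - 1\<close>. The sum over the \<open>l\<^sub>i\<close> is \<open>m!\<close> times the
  \<open>m\<close>-th coefficient of \<open>G\<^sup>n\<close>, and the sum over \<open>j\<close> and \<open>k\<close> is \<open>(N - m)!\<close> times a coefficient of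
  \<open>e\<^sup>x\<^sup>t\<close> multiplied by the exponential series of \<open>n c (1 - e\<^sup>t)\<close> truncated after the power \<open>N\<close>. As
  \<open>1 - e\<^sup>t\<close> has no constant term, the truncation is invisible up to order \<open>N\<close>. Hence the
  right-hand side is \<open>x N!\<close> times the \<open>N\<close>-th coefficient of
  \<open>exp (- n b t - n c (1 - e\<^sup>t)) e\<^sup>x\<^sup>t exp (n c (1 - e\<^sup>t)) = exp ((x - n b) t)\<close>.
\<close>

unbundle fps_syntax

text \<open>The product of the exponentials of \<open>A\<close>, \<open>B\<close> and
  \<open>- (A + B)\<close> has derivative zero and constant term 1, hence equals 1. The case
  \<open>B = 0\<close> makes the exponential of \<open>- (F + G)\<close> the inverse of that of
  \<open>F + G\<close>, and multiplying by the latter gives the claim.\<close>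

lemma fps_exp_compose_add:
  fixes F G :: "'a::field_char_0 fps"
  assumes [simp]: "F $ 0 = 0" "G $ 0 = 0"
  shows "fps_exp 1 oo (F + G) = (fps_exp 1 oo F) * (fps_exp 1 oo G)"
proof -
  have const: "(fps_exp 1 oo A) * (fps_exp 1 oo B) * (fps_exp 1 oo (- (A + B))) = 1"
    if [simp]: "A $ 0 = 0" "B $ 0 = 0" for A B :: "'a fps"
  proof -
    let ?P = "(fps_exp 1 oo A) * (fps_exp 1 oo B) * (fps_exp 1 oo (- (A + B)))"
    have "fps_deriv ?P = 0"
      by (simp add: fps_compose_deriv algebra_simps)
    then have "?P = fps_const (?P $ 0)"
      by (simp only: fps_deriv_eq_0_iff)
    then show ?thesis by simp
  qed
  have inv: "(fps_exp 1 oo (F + G)) * (fps_exp 1 oo (- (F + G))) = 1"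
    using const[of "F + G" 0] by simp
  have "fps_exp 1 oo (F + G) =
      ((fps_exp 1 oo F) * (fps_exp 1 oo G) * (fps_exp 1 oo (- (F + G)))) * (fps_exp 1 oo (F + G))"
    by (simp only: const[OF assms] mult_1_left)
  also have "\<dots> = (fps_exp 1 oo F) * (fps_exp 1 oo G) *
      ((fps_exp 1 oo (F + G)) * (fps_exp 1 oo (- (F + G))))"
    by (simp only: mult_ac)
  finally show ?thesis by (simp only: inv mult_1_right)
qed

lemma fps_exp_compose_power:
  fixes F :: "'a::field_char_0 fps"
  assumes "F $ 0 = 0"
  shows "(fps_exp 1 oo F) ^ n = fps_exp 1 oo (of_nat n * F)"
  by (induction n) (simp_all add: assms fps_exp_compose_add distrib_right)

text \<open>As \<open>F\<close> has no constant term, \<open>F ^ k\<close> has no coefficient below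
  order \<open>k\<close>, so powers beyond \<open>i\<close> do not reach coefficient
  \<open>i\<close>.\<close>

lemma fps_exp_compose_nth_truncated:
  fixes F :: "'a::field_char_0 fps"
  assumes "F $ 0 = 0" and "i \<le> N"
  shows "(fps_exp 1 oo F) $ i = (\<Sum>k=0..N. fps_const (1 / fact k) * F ^ k) $ i"
proof -
  have "(fps_exp 1 oo F) $ i = (\<Sum>k=0..i. 1 / fact k * (F ^ k $ i))"
    by (simp add: fps_compose_nth)
  also have "\<dots> = (\<Sum>k=0..N. 1 / fact k * (F ^ k $ i))"
    using assms by (intro sum.mono_neutral_left) (auto simp: startsby_zero_power_prefix)
  finally show ?thesis by (simp add: fps_sum_nth)
qed

lemma fps_mult_nth_cong:
  fixes F G H :: "'a::comm_ring_1 fps"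
  assumes "\<And>i. i \<le> N \<Longrightarrow> F $ i = G $ i"
  shows "(H * F) $ N = (H * G) $ N"
  using assms by (auto simp: fps_mult_nth intro!: sum.cong)

text \<open>The factorials in the actuarial polynomials cancel the denominator of the multinomial
  coefficient; what remains is the expansion of a coefficient of an \<open>n\<close>-th
  power.\<close>

lemma sum_multinomial_actuarial:
  assumes "n \<ge> 1"
  shows "(\<Sum>ls | length ls = n \<and> sum_list ls = m.
            multinomial_coeff m ls * (\<Prod>i<n. actuarial_poly (ls ! i) \<beta> y))
         = fact m * (actuarial_gf \<beta> y ^ n) $ m"
proof -
  have "multinomial_coeff m ls * (\<Prod>i<n. actuarial_poly (ls ! i) \<beta> y)
      = fact m * (\<Prod>i<n. actuarial_gf \<beta> y $ (ls ! i))" if "length ls = n" for ls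
  proof -
    have "(\<Prod>l\<leftarrow>ls. fact l) = (\<Prod>i<n. fact (ls ! i) :: complex)"
      using that by (simp add: prod.list_conv_set_nth atLeast0LessThan)
    then show ?thesis
      by (simp add: multinomial_coeff_def actuarial_poly_def prod.distrib)
  qed
  moreover have "(actuarial_gf \<beta> y ^ n) $ m
      = (\<Sum>ls | length ls = n \<and> sum_list ls = m. \<Prod>i<n. actuarial_gf \<beta> y $ (ls ! i))"
  proof -
    \<comment> \<open>\<open>fps_power_nth\<close> runs its product over \<open>{0..n - 1}\<close>,
      which for \<open>n = 0\<close> would be \<open>{0}\<close> and not empty.\<close>
    have "{0..n - 1} = {..<n}" using assms by auto
    then show ?thesis using assms by (simp add: fps_power_nth natpermute_def)
  qed
  ultimately show ?thesis
    by (simp add: sum_distrib_left)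
qed

text \<open>The binomial theorem; absorbing each power of the exponential into
  \<open>fps_exp x\<close> produces the shifts \<open>x + j\<close>.\<close>

lemma fps_exp_times_one_minus_exp_power:
  fixes x :: "'a::field_char_0"
  shows "fps_exp x * (1 - fps_exp 1) ^ k =
    (\<Sum>j=0..k. fps_const (of_nat (k choose j) * (- 1) ^ j) * fps_exp (x + of_nat j))"
proof -
  have "(1 - fps_exp 1 :: 'a fps) ^ k = (- fps_exp 1 + 1) ^ k"
    by simp
  also have "\<dots> = (\<Sum>j=0..k. of_nat (k choose j) * (- fps_exp 1) ^ j)"
    by (subst binomial_ring) (simp add: atLeast0AtMost)
  also have "\<dots> = (\<Sum>j=0..k. fps_const (of_nat (k choose j) * (- 1) ^ j) * fps_exp (of_nat j))"
  proof (rule sum.cong[OF refl])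
    fix j
    have "(- fps_exp 1 :: 'a fps) ^ j = (- 1) ^ j * fps_exp (of_nat j)"
      by (subst power_minus) (simp add: fps_exp_power_mult)
    moreover have "(- 1 :: 'a fps) ^ j = fps_const ((- 1) ^ j)"
      by (simp flip: fps_const_power fps_const_neg)
    ultimately show "of_nat (k choose j) * (- fps_exp 1 :: 'a fps) ^ j
        = fps_const (of_nat (k choose j) * (- 1) ^ j) * fps_exp (of_nat j)"
      by (simp add: fps_of_nat mult.assoc flip: fps_const_mult)
  qed
  finally show ?thesis
    by (simp add: sum_distrib_left fps_exp_add_mult mult_ac)
qed

theorem theorem3:
  fixes n :: nat and b c x :: complex
  assumes "n \<ge> 1" and "b \<noteq> 0" and "c \<noteq> 0"
  shows "abel_poly n b x =
    x * (\<Sum>m=0..n-1. \<Sum>ls | length ls = n \<and> sum_list ls = m. \<Sum>k=0..n-1. \<Sum>j=0..k.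
      of_nat ((n - 1) choose m) * multinomial_coeff m ls * of_nat (k choose j) *
      (\<Prod>i<n. actuarial_poly (ls ! i) (- b) (- c)) *
      ((- 1) ^ j * (of_nat n * c) ^ k / fact k) *
      (x + of_nat j) ^ (n - 1 - m))"
proof -
  define N where "N = n - 1"
  define D where "D = of_nat n * c"
  define F where "F = fps_const D * (1 - fps_exp 1 :: complex fps)"
  define Q where "Q = (\<Sum>k=0..N. fps_const (1 / fact k) * F ^ k)"
  have F0: "F $ 0 = 0" by (simp add: F_def)
  have G: "actuarial_gf (- b) (- c) ^ n = fps_exp 1 oo (fps_const (- (of_nat n * b)) * fps_X - F)"
  proof -
    have const: "fps_const (y * of_nat n) = fps_const y * of_nat n" for y :: complex
      by (simp add: fps_of_nat flip: fps_const_mult)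
    have "of_nat n * (fps_const (- b) * fps_X + fps_const (- c) * (1 - fps_exp 1))
        = fps_const (- (of_nat n * b)) * fps_X - F"
      by (simp add: F_def D_def const algebra_simps del: fps_const_neg fps_const_mult
          flip: fps_const_neg)
    then show ?thesis
      by (simp add: actuarial_gf_def fps_exp_compose_power)
  qed
  have inner: "(\<Sum>k=0..N. \<Sum>j=0..k. of_nat (k choose j) * ((- 1) ^ j * D ^ k / fact k) *
      (x + of_nat j) ^ i) = fact i * (fps_exp x * Q) $ i" for i
  proof -
    have "fps_exp x * Q =
        (\<Sum>k=0..N. fps_const (D ^ k / fact k) * (fps_exp x * (1 - fps_exp 1) ^ k))"
      unfolding Q_def sum_distrib_left
    proof (rule sum.cong[OF refl])
      fix k
      have "fps_const (D ^ k / fact k) = fps_const (1 / fact k) * fps_const D ^ k"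
        by simp
      then show "fps_exp x * (fps_const (1 / fact k) * F ^ k)
          = fps_const (D ^ k / fact k) * (fps_exp x * (1 - fps_exp 1) ^ k)"
        by (simp only: F_def power_mult_distrib mult_ac)
    qed
    also have "\<dots> $ i = (\<Sum>k=0..N. \<Sum>j=0..k. of_nat (k choose j) * ((- 1) ^ j * D ^ k / fact k) *
      (x + of_nat j) ^ i) / fact i"
      by (simp add: fps_exp_times_one_minus_exp_power fps_sum_nth sum_distrib_left
          sum_divide_distrib mult_ac)
    finally show ?thesis by simp
  qed
  have "(\<Sum>m=0..N. \<Sum>ls | length ls = n \<and> sum_list ls = m. \<Sum>k=0..N. \<Sum>j=0..k.
      of_nat (N choose m) * multinomial_coeff m ls * of_nat (k choose j) *
      (\<Prod>i<n. actuarial_poly (ls ! i) (- b) (- c)) *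
      ((- 1) ^ j * D ^ k / fact k) * (x + of_nat j) ^ (N - m))
    = (\<Sum>m=0..N. of_nat (N choose m) *
        (\<Sum>ls | length ls = n \<and> sum_list ls = m.
          multinomial_coeff m ls * (\<Prod>i<n. actuarial_poly (ls ! i) (- b) (- c))) *
        (\<Sum>k=0..N. \<Sum>j=0..k. of_nat (k choose j) * ((- 1) ^ j * D ^ k / fact k) *
          (x + of_nat j) ^ (N - m)))"
    unfolding mult.assoc sum_distrib_right
    unfolding sum_distrib_left
    by (intro sum.cong refl) (simp only: mult_ac)
  \<comment> \<open>For \<open>m \<le> N\<close>, the binomial coefficient times
    \<open>fact m * fact (N - m)\<close> is \<open>fact N\<close>, which leaves a Cauchy
    product.\<close>
  also have "\<dots> = (\<Sum>m=0..N. fact N * ((actuarial_gf (- b) (- c) ^ n) $ m * (fps_exp x * Q) $ (N - m)))"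
    unfolding inner sum_multinomial_actuarial[OF assms(1)]
    by (intro sum.cong refl) (simp add: binomial_fact)
  also have "\<dots> = fact N * ((actuarial_gf (- b) (- c) ^ n * fps_exp x) * Q) $ N"
    by (simp only: mult.assoc fps_mult_nth[of "actuarial_gf (- b) (- c) ^ n"] sum_distrib_left)
  also have "((actuarial_gf (- b) (- c) ^ n * fps_exp x) * Q) $ N
      = ((actuarial_gf (- b) (- c) ^ n * fps_exp x) * (fps_exp 1 oo F)) $ N"
    \<comment> \<open>Coefficient \<open>N\<close> of the product sees only coefficients of
      \<open>Q\<close> up to \<open>N\<close>, where \<open>Q\<close> agrees with the full
      exponential of \<open>F\<close>.\<close>
    by (rule fps_mult_nth_cong) (simp add: Q_def fps_exp_compose_nth_truncated[OF F0])
  also have "(actuarial_gf (- b) (- c) ^ n * fps_exp x) * (fps_exp 1 oo F)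
      = fps_exp x * ((fps_exp 1 oo (fps_const (- (of_nat n * b)) * fps_X - F)) * (fps_exp 1 oo F))"
    by (simp only: G mult_ac)
  also have "\<dots> = fps_exp x * (fps_exp 1 oo (fps_const (- (of_nat n * b)) * fps_X))"
    by (subst fps_exp_compose_add[symmetric]) (simp_all add: F0)
  also have "\<dots> = fps_exp (x - b * of_nat n)"
    by (simp add: mult.commute[of b] flip: fps_exp_add_mult)
  also have "fact N * \<dots> $ N = (x - b * of_nat n) ^ N"
    by simp
  finally show ?thesis
    using assms(1) by (simp add: abel_poly_def N_def D_def)
qed

end
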